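(* Let $\mathbf{vtm}$ be the fixed point starting with $0$ of the morphism $f:0\mapsto012$, $1\mapsto02$, $2\mapsto1$. Then its additive complexity is the sequence $13^\omega$, i.e., $\rho^{\mathrm{add}}_{\mathbf{vtm}}(0)=1$ and $\rho^{\mathrm{add}}_{\mathbf{vtm}}(n)=3$ for all $n\ge1$.
   Context: Letters $0,1,2$ are regarded as integers. Words $u,v$ are additively equivalent if $|u|=|v|$ and $|u|_1+2|u|_2=|v|_1+2|v|_2$ ($|w|_a$ counts occurrences of $a$); $\rho^{\mathrm{add}}_{\mathbf{x}}(n)$ is the number of additive equivalence classes of length-$n$ factors of $\mathbf{x}$. *)

theory Defs
  imports "HOL-Library.Stream"
begin

text \<open>
  Words are lists and infinite words are streams; the letters are natural numbers.
\<close>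

definition factors :: "'a stream \<Rightarrow> nat \<Rightarrow> 'a list set" where
  "factors x n = {stake n (sdrop i x) | i. True}"

definition additive_equiv :: "(nat list \<times> nat list) set" where
  "additive_equiv = {(u, v). length u = length v \<and>
     count_list u 1 + 2 * count_list u 2 = count_list v 1 + 2 * count_list v 2}"

definition additive_complexity :: "nat stream \<Rightarrow> nat \<Rightarrow> nat" where
  "additive_complexity x n = card (factors x n // additive_equiv)"

text \<open>
  Only the letters 0, 1, 2 matter: the value on other numbers is a dummy, chosen nonempty
  because \<^const>\<open>flat\<close> is the infinite concatenation only for nonempty words.
\<close>

definition vtm_morphism :: "nat \<Rightarrow> nat list" where
  "vtm_morphism a =
     (if a = 0 then [0, 1, 2] else if a = 1 then [0, 2] else if a = 2 then [1] else [a])"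

definition vtm :: "nat stream" where
  "vtm = (THE x. shd x = 0 \<and> flat (smap vtm_morphism x) = x)"

text \<open>The rest of the theory shows that the description of \<^const>\<open>vtm\<close> is proper.\<close>

lemma vtm_morphism_nonempty [simp]: "vtm_morphism a \<noteq> []"
  by (simp add: vtm_morphism_def)

lemma flat_smap_vtm_morphism:
  "flat (smap vtm_morphism x) = vtm_morphism (shd x) @- flat (smap vtm_morphism (stl x))"
  by (cases x) simp

primcorec queue_stream :: "nat list \<Rightarrow> nat stream" where
  "shd (queue_stream q) = hd q"
| "stl (queue_stream q) = queue_stream (tl q @ vtm_morphism (hd q))"

lemma queue_stream_eq:
  assumes "q \<noteq> []"
  shows "queue_stream q = q @- flat (smap vtm_morphism (queue_stream q))"
  using assms
proof (coinduction arbitrary: q)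
  case (Eq_stream q)
  then have "stl (q @- flat (smap vtm_morphism (queue_stream q))) =
      (tl q @ vtm_morphism (hd q)) @-
        flat (smap vtm_morphism (queue_stream (tl q @ vtm_morphism (hd q))))"
    by (subst flat_smap_vtm_morphism) simp
  with Eq_stream show ?case
    by (auto intro!: exI[of _ "tl q @ vtm_morphism (hd q)"])
qed

lemma queue_stream_unique:
  assumes "q \<noteq> []" and "y = q @- flat (smap vtm_morphism y)"
  shows "y = queue_stream q"
  using assms
proof (coinduction arbitrary: q y)
  case (Eq_stream q y)
  have hd: "shd y = hd q"
    using Eq_stream by (metis shift_simps(1))
  have "stl y = tl q @- flat (smap vtm_morphism y)"
    using Eq_stream by (metis shift_simps(2))
  also have "\<dots> = (tl q @ vtm_morphism (hd q)) @- flat (smap vtm_morphism (stl y))"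
    by (subst flat_smap_vtm_morphism) (simp add: hd)
  finally show ?case
    using hd by (auto intro!: exI[of _ "tl q @ vtm_morphism (hd q)"])
qed

lemma vtm_exists_unique: "\<exists>!x. shd x = 0 \<and> flat (smap vtm_morphism x) = x"
proof (rule ex1I)
  let ?x = "0 ## queue_stream [1, 2]"
  have "flat (smap vtm_morphism ?x) =
      0 ## ([1, 2] @- flat (smap vtm_morphism (queue_stream [1, 2])))"
    by (subst flat_smap_vtm_morphism) (simp add: vtm_morphism_def)
  then show "shd ?x = 0 \<and> flat (smap vtm_morphism ?x) = ?x"
    using queue_stream_eq[of "[1, 2]"] by simp
next
  fix x assume x: "shd x = 0 \<and> flat (smap vtm_morphism x) = x"
  have "flat (smap vtm_morphism x) = 0 ## ([1, 2] @- flat (smap vtm_morphism (stl x)))"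
    by (subst flat_smap_vtm_morphism) (simp add: vtm_morphism_def x)
  with x have "x = 0 ## ([1, 2] @- flat (smap vtm_morphism (stl x)))"
    by metis
  then have "stl x = [1, 2] @- flat (smap vtm_morphism (stl x))"
    by (metis stream.sel(2))
  then have "stl x = queue_stream [1, 2]"
    by (intro queue_stream_unique) simp_all
  with x show "x = 0 ## queue_stream [1, 2]"
    by (metis stream.collapse)
qed

lemma shd_vtm: "shd vtm = 0" and vtm_fixed_point: "flat (smap vtm_morphism vtm) = vtm"
  using theI'[OF vtm_exists_unique] by (simp_all add: vtm_def)

end

(*
  Write t for the Thue-Morse word. The letter of vtm at position i is 1 + t(i) - t(i+1), so the
  weight of the factor of length n at position i telescopes to n + t(i) - t(i+n). This leaves only
  the values n - 1, n, n + 1, and all of them occur for n > 0: t(i) and t(i+n) are neither always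
  equal nor always different, and the set of factors of t is closed under complement.
*)
theory Submission
  imports Defs
begin

text \<open>Parity of the number of ones in the binary expansion.\<close>

fun thue_morse :: "nat \<Rightarrow> bool" where
  "thue_morse n = (if n = 0 then False else thue_morse (n div 2) \<noteq> odd n)"

declare thue_morse.simps [simp del]

lemma thue_morse_0 [simp]: "\<not> thue_morse 0"
  by (simp add: thue_morse.simps)

lemma thue_morse_double [simp]: "thue_morse (2 * n) = thue_morse n"
  by (cases "n = 0") (simp_all add: thue_morse.simps[of "2 * n"])

lemma thue_morse_Suc_double [simp]: "thue_morse (Suc (2 * n)) = (\<not> thue_morse n)"
  by (simp add: thue_morse.simps[of "Suc (2 * n)"])

text \<open>The summand \<open>2 ^ k\<close> contributes one new binary digit 1 above all digits of
  \<open>i\<close>.\<close>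

lemma thue_morse_add_power:
  "i < 2 ^ k \<Longrightarrow> thue_morse (i + 2 ^ k) = (\<not> thue_morse i)"
proof (induction k arbitrary: i)
  case 0
  then show ?case using thue_morse_Suc_double[of 0] by simp
next
  case (Suc k)
  obtain j where "i = 2 * j \<or> i = Suc (2 * j)"
    by (metis oddE evenE Suc_eq_plus1)
  with Suc show ?case
    using thue_morse_double[of "j + 2 ^ k"] thue_morse_Suc_double[of "j + 2 ^ k"]
    by (auto simp: distrib_left)
qed

text \<open>An even shift reduces to its half, since doubling preserves the letter. An odd shift
  \<open>2 * m + 1\<close> is compared at \<open>2 * i\<close> and \<open>2 * i + 1\<close>: a
  constant correlation would make the letters at \<open>i + m\<close> and \<open>i + m + 1\<close>
  equal for every \<open>i\<close>.\<close>

lemma thue_morse_correlation_not_constant: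
  assumes "n > 0"
  shows "\<exists>i. (thue_morse i = thue_morse (i + n)) \<noteq> c"
  using assms
proof (induction n rule: less_induct)
  case (less n)
  show ?case
  proof (cases "even n")
    case True
    then obtain m where n: "n = 2 * m" by blast
    with less obtain i where "(thue_morse i = thue_morse (i + m)) \<noteq> c" by force
    then show ?thesis
      using thue_morse_double[of i] thue_morse_double[of "i + m"]
      by (metis n distrib_left)
  next
    case False
    then obtain m where n: "n = Suc (2 * m)" by (metis oddE Suc_eq_plus1)
    show ?thesis
    proof (rule ccontr)
      assume "\<nexists>i. (thue_morse i = thue_morse (i + n)) \<noteq> c"
      then have const: "(thue_morse i = thue_morse (i + n)) = c" for i by blast
      have "thue_morse (i + m) = thue_morse (Suc (i + m))" for i
        using const[of "2 * i"] const[of "Suc (2 * i)"]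
          thue_morse_Suc_double[of "i + m"] thue_morse_double[of "Suc (i + m)"]
        by (auto simp: n)
      \<comment> \<open>Here the positions are \<open>2 * m\<close> and \<open>2 * m + 1\<close>,
        which always carry different letters.\<close>
      from this[of m] show False
        using thue_morse_double[of m] thue_morse_Suc_double[of m] by (simp add: mult_2)
    qed
  qed
qed

lemma thue_morse_ascent_descent:
  assumes "n > 0"
  shows "\<exists>i. \<not> thue_morse i \<and> thue_morse (i + n)"
    and "\<exists>i. thue_morse i \<and> \<not> thue_morse (i + n)"
proof -
  obtain i where i: "thue_morse i \<noteq> thue_morse (i + n)"
    using thue_morse_correlation_not_constant[OF assms, of True] by auto
  have less: "i + n < 2 ^ (i + n)" by simp
  \<comment> \<open>Both \<open>i\<close> and \<open>i + n\<close> lie below this power of two, so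
    one shift complements both letters and turns an ascent into a descent or conversely.\<close>
  let ?j = "i + 2 ^ (i + n)"
  have j: "thue_morse ?j = (\<not> thue_morse i)"
    by (rule thue_morse_add_power) (use less in linarith)
  have jn: "thue_morse (?j + n) = (\<not> thue_morse (i + n))"
    using thue_morse_add_power[OF less] by (simp add: ac_simps)
  show "\<exists>i. \<not> thue_morse i \<and> thue_morse (i + n)"
    and "\<exists>i. thue_morse i \<and> \<not> thue_morse (i + n)"
    using i j jn by blast+
qed

definition thue_morse_diff :: "nat \<Rightarrow> nat" where
  "thue_morse_diff i = 1 + of_bool (thue_morse i) - of_bool (thue_morse (Suc i))"

text \<open>The start is a parameter so that every tail has the same form and inductions can
  generalize over it.\<close>

definition thue_morse_diffs :: "nat \<Rightarrow> nat stream" where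
  "thue_morse_diffs i = smap thue_morse_diff (fromN i)"

lemma thue_morse_diffs_unfold:
  "thue_morse_diffs i = thue_morse_diff i ## thue_morse_diffs (Suc i)"
  unfolding thue_morse_diffs_def by (subst siterate.code) simp

lemma sdrop_thue_morse_diffs: "sdrop n (thue_morse_diffs i) = thue_morse_diffs (i + n)"
  by (simp add: thue_morse_diffs_def sdrop_smap sdrop_siterate add.commute)

text \<open>
  The lengths of the images of 0, 1, 2 are 3, 2, 1, so the image of the first \<open>i\<close> letters has
  length \<open>2 * i + t(i)\<close>, again by telescoping.
\<close>

lemma thue_morse_diffs_block:
  "thue_morse_diffs (2 * i + of_bool (thue_morse i)) =
     vtm_morphism (thue_morse_diff i) @-
       thue_morse_diffs (2 * Suc i + of_bool (thue_morse (Suc i)))"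
proof -
  \<comment> \<open>The block starts at \<open>2 * i\<close> or \<open>2 * i + 1\<close> and the
    next one at \<open>2 * i + 2\<close> or \<open>2 * i + 3\<close>, so these three letters
    suffice.\<close>
  have unfold: "thue_morse_diffs (2 * i) =
      thue_morse_diff (2 * i) ## thue_morse_diffs (Suc (2 * i))"
    "thue_morse_diffs (Suc (2 * i)) =
      thue_morse_diff (Suc (2 * i)) ## thue_morse_diffs (2 * Suc i)"
    "thue_morse_diffs (2 * Suc i) =
      thue_morse_diff (2 * Suc i) ## thue_morse_diffs (Suc (2 * Suc i))"
    using thue_morse_diffs_unfold[of "2 * i"] thue_morse_diffs_unfold[of "Suc (2 * i)"]
      thue_morse_diffs_unfold[of "2 * Suc i"] by simp_all
  have diff_double: "thue_morse_diff (2 * i) = (if thue_morse i then 2 else 0)" for i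
    by (simp add: thue_morse_diff_def)
  moreover have "thue_morse_diff (Suc (2 * i)) =
      1 + of_bool (\<not> thue_morse i) - of_bool (thue_morse (Suc i))"
    using thue_morse_double[of "Suc i"] by (simp add: thue_morse_diff_def)
  ultimately show ?thesis
    using unfold diff_double[of "Suc i"]
    by (cases "thue_morse i"; cases "thue_morse (Suc i)")
       (simp_all add: thue_morse_diff_def[of i] vtm_morphism_def)
qed

text \<open>Both sides start with the same nonempty block, and removing it lowers the position to be
  compared.\<close>

lemma flat_smap_thue_morse_diffs:
  "flat (smap vtm_morphism (thue_morse_diffs i)) =
     thue_morse_diffs (2 * i + of_bool (thue_morse i))"
proof -
  have "flat (smap vtm_morphism (thue_morse_diffs i)) !! n =
      thue_morse_diffs (2 * i + of_bool (thue_morse i)) !! n" for n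
  proof (induction n arbitrary: i rule: less_induct)
    case (less n)
    let ?w = "vtm_morphism (thue_morse_diff i)"
    have w: "length ?w > 0" by simp
    have "flat (smap vtm_morphism (thue_morse_diffs i)) =
        ?w @- flat (smap vtm_morphism (thue_morse_diffs (Suc i)))"
      by (subst thue_morse_diffs_unfold) simp
    then show ?case
      using less[of "n - length ?w" "Suc i"] w unfolding thue_morse_diffs_block[of i]
      by (cases "n < length ?w")
         (simp_all add: shift_snth_less shift_snth_ge del: length_greater_0_conv)
  qed
  then show ?thesis
    by (metis stream_smap_nats smap_alt)
qed

text \<open>As \<open>thue_morse 0\<close> is false, the block of index 0 starts at position 0, so
  the stream is a fixed point and uniqueness applies.\<close>

lemma vtm_eq_thue_morse_diffs: "vtm = thue_morse_diffs 0"
proof -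
  have "shd (thue_morse_diffs 0) = 0"
    using thue_morse_Suc_double[of 0]
    by (subst thue_morse_diffs_unfold) (simp add: thue_morse_diff_def)
  then show ?thesis
    using vtm_exists_unique shd_vtm vtm_fixed_point flat_smap_thue_morse_diffs[of 0]
    by (metis add_0 mult_0_right of_bool_eq(1) thue_morse_0)
qed

definition weight :: "nat list \<Rightarrow> nat" where
  "weight w = count_list w 1 + 2 * count_list w 2"

text \<open>The telescoping sum, stated additively to avoid truncated subtraction.\<close>

lemma weight_stake_thue_morse_diffs:
  "weight (stake n (thue_morse_diffs i)) + of_bool (thue_morse (i + n)) =
     n + of_bool (thue_morse i)"
proof (induction n arbitrary: i)
  case (Suc n)
  have "stake (Suc n) (thue_morse_diffs i) =
      thue_morse_diff i # stake n (thue_morse_diffs (Suc i))"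
    by (simp add: thue_morse_diffs_unfold[of i])
  with Suc[of "Suc i"] show ?case
    by (auto simp: weight_def thue_morse_diff_def of_bool_def split: if_splits)
qed (simp add: weight_def)

lemma weight_factors_vtm:
  "weight ` factors vtm n =
     range (\<lambda>i. n + of_bool (thue_morse i) - of_bool (thue_morse (i + n)))"
proof -
  have "weight (stake n (sdrop i vtm)) =
      n + of_bool (thue_morse i) - of_bool (thue_morse (i + n))" for i
    using weight_stake_thue_morse_diffs[of n i]
    by (simp add: vtm_eq_thue_morse_diffs sdrop_thue_morse_diffs)
  moreover have "factors vtm n = range (\<lambda>i. stake n (sdrop i vtm))"
    by (auto simp: factors_def)
  ultimately show ?thesis
    by (simp add: image_image)
qed

lemma additive_complexity_eq_card_weight:
  "additive_complexity x n = card (weight ` factors x n)"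
proof -
  let ?class = "\<lambda>s. {v. length v = n \<and> weight v = s}"
  have len: "length u = n" if "u \<in> factors x n" for u
    using that by (auto simp: factors_def)
  have "factors x n // additive_equiv = (\<lambda>u. additive_equiv `` {u}) ` factors x n"
    by (auto simp: quotient_def)
  also have "\<dots> = (\<lambda>u. ?class (weight u)) ` factors x n"
    by (intro image_cong refl) (auto simp: additive_equiv_def weight_def len)
  finally have "factors x n // additive_equiv = ?class ` weight ` factors x n"
    by (simp add: image_image)
  \<comment> \<open>A class over an attained weight is inhabited, hence determines that
    weight.\<close>
  moreover have "inj_on ?class (weight ` factors x n)"
    using len by (auto intro!: inj_onI)
  ultimately show ?thesis
    by (simp add: additive_complexity_def card_image)
qed

theorem theorem4p7:
  shows "additive_complexity vtm 0 = 1 \<and> (\<forall>n\<ge>1. additive_complexity vtm n = 3)"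
proof (intro conjI allI impI)
  show "additive_complexity vtm 0 = 1"
    by (simp add: additive_complexity_eq_card_weight weight_factors_vtm)
next
  fix n :: nat
  assume n: "n \<ge> 1"
  let ?s = "\<lambda>i. n + of_bool (thue_morse i) - of_bool (thue_morse (i + n))"
  \<comment> \<open>An ascent, a descent and, from the correlation with \<open>c\<close> false, a
    pair of equal letters.\<close>
  obtain i j k where "\<not> thue_morse i" "thue_morse (i + n)" "thue_morse j" "\<not> thue_morse (j + n)"
    "thue_morse k = thue_morse (k + n)"
    using n thue_morse_ascent_descent[of n] thue_morse_correlation_not_constant[of n False] by auto
  then have "?s i = n - 1" "?s j = n + 1" "?s k = n"
    by simp_all
  then have "{n - 1, n, n + 1} \<subseteq> range ?s"
    by (metis (mono_tags, lifting) empty_subsetI insert_subset rangeI)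
  moreover have "range ?s \<subseteq> {n - 1, n, n + 1}"
    by (auto simp: of_bool_def split: if_splits)
  ultimately have "weight ` factors vtm n = {n - 1, n, n + 1}"
    unfolding weight_factors_vtm by (rule subset_antisym[rotated])
  \<comment> \<open>Since \<open>n\<close> is positive, \<open>n - 1\<close> differs from
    \<open>n\<close>, so the three values are distinct.\<close>
  then show "additive_complexity vtm n = 3"
    using n by (auto simp: additive_complexity_eq_card_weight card_insert_if)
qed

end
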